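(* Let $B=\{1,2,3,4,5,6\}\in\triangle_3$. For every partition $B=X\cup Y$ with $X\cap Y=\emptyset$, there exists $Z\in\triangle_2(B)$ with $Z\subseteq X$ or $Z\subseteq Y$. (That is, the game Mines$_3$ never ends in a draw.)
   Context: $T_n=n(n+1)/2$, $T_0=0$. A finite set $X\subseteq\mathbb{N}$ with $|X|=T_n$, enumerated $x_1<\dots<x_{T_n}$, has $i$-th level $\{x_{T_{i-1}+1},\dots,x_{T_i}\}$ for $1\le i\le n$; $\triangle_n$ is the set of all $X\subseteq\mathbb{N}$ with $|X|=T_n$. For such sets $X,Y$, $X\le Y$ means $X\subseteq Y$ and every level of $X$ is contained in a single level of $Y$, distinct levels of $X$ being contained in distinct levels of $Y$. $\triangle_k(B)=\{Z\in\triangle_k: Z\le B\}$. In the game Mines$_3$, two players alternately mark positions of $B$; $X$ and $Y$ are the sets of positions marked by players one and two. *)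

theory Defs
  imports Main
begin

definition T :: "nat \<Rightarrow> nat" where
  "T n = n * (n + 1) div 2"

definition triangle :: "nat \<Rightarrow> nat set set" where
  "triangle n = {X. finite X \<and> card X = T n}"

text \<open>\<open>elem X j\<close> is the \<open>j\<close>-th smallest element of the finite set \<open>X\<close>, counted from 1.
  It is meaningful only for \<open>1 \<le> j \<le> card X\<close>.\<close>
definition elem :: "nat set \<Rightarrow> nat \<Rightarrow> nat" where
  "elem X j = sorted_list_of_set X ! (j - 1)"

text \<open>For \<open>X \<in> triangle n\<close>, levels are indexed by \<open>1 \<le> i \<le> n\<close>; other indices are never used.\<close>
definition level :: "nat set \<Rightarrow> nat \<Rightarrow> nat set" where
  "level X i = elem X ` {T (i - 1) + 1..T i}"

text \<open>The heights \<open>m\<close> and \<open>n\<close> are determined by \<open>X\<close> and \<open>Y\<close>, since \<open>T\<close> is injective. The map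
  \<open>f\<close> sends the index of a level of \<open>X\<close> to the index of the level of \<open>Y\<close> containing it.\<close>
definition triangle_le :: "nat set \<Rightarrow> nat set \<Rightarrow> bool" where
  "triangle_le X Y \<longleftrightarrow> X \<subseteq> Y \<and>
     (\<exists>m n. X \<in> triangle m \<and> Y \<in> triangle n \<and>
       (\<exists>f. f ` {1..m} \<subseteq> {1..n} \<and> inj_on f {1..m} \<and>
            (\<forall>i\<in>{1..m}. level X i \<subseteq> level Y (f i))))"

definition triangles_below :: "nat \<Rightarrow> nat set \<Rightarrow> nat set set" where
  "triangles_below k B = {Z \<in> triangle k. triangle_le Z B}"

lemma board_in_triangle_3: "{1, 2, 3, 4, 5, 6} \<in> triangle 3"
  by (simp add: triangle_def T_def)

end

theory Submission imports Defs begin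

text \<open>The levels of the board are \<open>{1}\<close>, \<open>{2, 3}\<close> and \<open>{4, 5, 6}\<close>. By the pigeonhole principle
  one player owns two positions of the bottom level. Any position of that player in a higher
  level completes a triangle; if there is none, the opponent owns the triangle \<open>{1, 2, 3}\<close>.\<close>

lemma level_triple:
  assumes "a < b" "b < c"
  shows "level {a, b, c} 1 = {a}" and "level {a, b, c} 2 = {b, c}"
proof -
  have "sorted_list_of_set {a, b, c} = [a, b, c]"
    using assms by simp
  \<comment> \<open>The ranks that make up each level, from \<open>T 0 = 0\<close>,
    \<open>T 1 = 1\<close> and \<open>T 2 = 3\<close>.\<close>
  moreover have "{T (1 - 1) + 1..T 1} = {1}" "{T (2 - 1) + 1..T 2} = {2, 3}"
    by (auto simp: T_def)
  ultimately show "level {a, b, c} 1 = {a}" "level {a, b, c} 2 = {b, c}"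
    by (simp_all add: level_def elem_def)
qed

lemma level_board:
  shows "level {1, 2, 3, 4, 5, 6} 1 = {1}"
    and "level {1, 2, 3, 4, 5, 6} 2 = {2, 3}"
    and "level {1, 2, 3, 4, 5, 6} 3 = {4, 5, 6}"
proof -
  have "sorted_list_of_set {1, 2, 3, 4, 5, 6 :: nat} = [1, 2, 3, 4, 5, 6]"
    by simp
  moreover have "{T (1 - 1) + 1..T 1} = {1}" "{T (2 - 1) + 1..T 2} = {2, 3}"
    "{T (3 - 1) + 1..T 3} = {4, 5, 6}"
    by (auto simp: T_def)
  ultimately show "level {1, 2, 3, 4, 5, 6} 1 = {1}" "level {1, 2, 3, 4, 5, 6} 2 = {2, 3}"
    "level {1, 2, 3, 4, 5, 6} 3 = {4, 5, 6}"
    by (simp_all add: level_def elem_def)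
qed

text \<open>Since the triple has levels \<open>{a}\<close> and \<open>{b, c}\<close>, being below
  \<open>Y\<close> amounts to \<open>b\<close> and \<open>c\<close> sharing a level of
  \<open>Y\<close> that differs from the level of \<open>a\<close>.\<close>

lemma triple_in_triangles_below_2:
  assumes Y: "Y \<in> triangle n" "{a, b, c} \<subseteq> Y"
    and abc: "a < b" "b < c"
    and ij: "i \<in> {1..n}" "j \<in> {1..n}" "i \<noteq> j"
    and levels: "a \<in> level Y i" "b \<in> level Y j" "c \<in> level Y j"
  shows "{a, b, c} \<in> triangles_below 2 Y"
proof -
  \<comment> \<open>The level map: \<open>{a}\<close> goes into level \<open>i\<close>,
    \<open>{b, c}\<close> into level \<open>j\<close>; it is injective because \<open>i\<close> and
    \<open>j\<close> differ.\<close>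
  let ?f = "\<lambda>k::nat. if k = 1 then i else j"
  have two: "{1..2::nat} = {1, 2}"
    by auto
  have Z: "{a, b, c} \<in> triangle 2"
    using abc by (simp add: triangle_def T_def)
  have "?f ` {1..2} \<subseteq> {1..n}" "inj_on ?f {1..2}"
    using ij unfolding two by auto
  moreover have "\<forall>k\<in>{1..2}. level {a, b, c} k \<subseteq> level Y (?f k)"
    using levels level_triple[OF abc] unfolding two by simp
  ultimately have "triangle_le {a, b, c} Y"
    unfolding triangle_le_def using Y Z by blast
  then show ?thesis
    using Z by (simp add: triangles_below_def)
qed

theorem theorem3:
  fixes B X Y :: "nat set"
  assumes "B = {1, 2, 3, 4, 5, 6}"
    and "B = X \<union> Y"
    and "X \<inter> Y = {}"
  shows "\<exists>Z\<in>triangles_below 2 B. Z \<subseteq> X \<or> Z \<subseteq> Y"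
proof -
  have B: "B \<in> triangle 3"
    using assms(1) board_in_triangle_3 by simp
  have top: "{1, 2, 3} \<in> triangles_below 2 B"
    by (rule triple_in_triangles_below_2[OF B, where i = 1 and j = 2])
      \<comment> \<open>Rewriting \<open>1\<close> to \<open>Suc 0\<close> would keep
        \<open>level_board\<close> from matching.\<close>
      (simp_all add: level_board assms(1) del: One_nat_def)
  have bottom: "{a, b, c} \<in> triangles_below 2 B"
    if "a \<in> {1, 2, 3}" "b \<in> {4, 5, 6}" "c \<in> {4, 5, 6}" "b < c" for a b c
    \<comment> \<open>The index \<open>i\<close> is the level of \<open>a\<close>: position 1 is
      alone in level 1, while 2 and 3 form level 2.\<close>
    by (rule triple_in_triangles_below_2[OF B, where i = "if a = 1 then 1 else 2" and j = 3])
      (use that in \<open>auto simp: level_board assms(1) simp del: One_nat_def\<close>)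
  \<comment> \<open>Stated for arbitrary \<open>S\<close> and \<open>S'\<close> so that either
    player can be the owner of \<open>b\<close> and \<open>c\<close>.\<close>
  have win: "\<exists>Z\<in>triangles_below 2 B. Z \<subseteq> S \<or> Z \<subseteq> S'"
    if S: "B = S \<union> S'" and bc: "b \<in> {4, 5, 6}" "c \<in> {4, 5, 6}" "b < c" "b \<in> S" "c \<in> S"
    for S S' b c
  proof (cases "\<exists>a\<in>{1, 2, 3}. a \<in> S")
    case True
    then obtain a where "a \<in> {1, 2, 3}" "a \<in> S"
      by blast
    then show ?thesis
      using bottom[of a b c] bc by (intro bexI[of _ "{a, b, c}"]) auto
  next
    case False
    then have "{1, 2, 3} \<subseteq> S'"
      using S assms(1) by blast
    then show ?thesis
      using top by blast
  qed
  have "4 \<in> X \<or> 4 \<in> Y" "5 \<in> X \<or> 5 \<in> Y" "6 \<in> X \<or> 6 \<in> Y"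
    using assms(1,2) by blast+
  \<comment> \<open>One case for each pair of bottom positions and each owner.\<close>
  then consider "4 \<in> X" "5 \<in> X" | "4 \<in> X" "6 \<in> X" | "5 \<in> X" "6 \<in> X"
    | "4 \<in> Y" "5 \<in> Y" | "4 \<in> Y" "6 \<in> Y" | "5 \<in> Y" "6 \<in> Y"
    by blast
  then show ?thesis
    using win[of X Y 4 5] win[of X Y 4 6] win[of X Y 5 6]
      win[of Y X 4 5] win[of Y X 4 6] win[of Y X 5 6] assms(2)
    \<comment> \<open>Exchanging the players turns the covering of \<open>B\<close> into
      \<open>Y \<union> X\<close>, hence \<open>Un_commute\<close>.\<close>
    by cases (auto simp: Un_commute)
qed

end
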